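(* For every integer $d\geq 2$ and every $d$-partite graph $F$, there exist $a_{F,d}\in\mathbb{Z}_{\geq 0}$ and $C_{F,d}\in\mathbb{Z}$ such that $$\mathrm{rk}\text{-}\mathrm{sat}(K^{(2)}_{n,d},F)=a_{F,d}\,n+C_{F,d}$$ for all sufficiently large $n$.
   Context: $K^{(2)}_{n,d}$ is the complete $d$-partite graph with $d$ parts each of size $n$. A matroid $M$ on $E(G)$ is weakly $F$-saturated if every copy $\tilde F$ of $F$ in $G$ is a cycle of $M$, i.e. $\mathrm{rk}_M(E(\tilde F)\setminus\{e\})=\mathrm{rk}_M(E(\tilde F))$ for all $e\in E(\tilde F)$; $\mathrm{rk}\text{-}\mathrm{sat}(G,F)$ is the maximum rank of a weakly $F$-saturated matroid on $E(G)$.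
   Formalization: The graph F is assumed to have at least one edge; for an edgeless F every matroid is weakly F-saturated and the saturation rank equals d(d-1)/2 times n squared, which is not linear in n. *)

theory Defs
  imports Main
begin

definition matroid :: "'e set \<Rightarrow> ('e set \<Rightarrow> bool) \<Rightarrow> bool" where
  "matroid E indep \<longleftrightarrow>
     finite E \<and>
     indep {} \<and>
     (\<forall>I. indep I \<longrightarrow> I \<subseteq> E) \<and>
     (\<forall>I J. indep I \<and> J \<subseteq> I \<longrightarrow> indep J) \<and>
     (\<forall>I J. indep I \<and> indep J \<and> card I < card J \<longrightarrow>
        (\<exists>x\<in>J - I. indep (insert x I)))"

definition mrank :: "('e set \<Rightarrow> bool) \<Rightarrow> 'e set \<Rightarrow> nat" where
  "mrank indep X = Max {card I | I. I \<subseteq> X \<and> indep I}"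

definition graph :: "'v set \<Rightarrow> 'v set set \<Rightarrow> bool" where
  "graph V Ed \<longleftrightarrow> finite V \<and> (\<forall>e\<in>Ed. e \<subseteq> V \<and> card e = 2)"

definition d_partite :: "nat \<Rightarrow> 'v set \<Rightarrow> 'v set set \<Rightarrow> bool" where
  "d_partite d V Ed \<longleftrightarrow>
     (\<exists>c :: 'v \<Rightarrow> nat. (\<forall>v\<in>V. c v < d) \<and>
        (\<forall>e\<in>Ed. \<forall>u\<in>e. \<forall>w\<in>e. u \<noteq> w \<longrightarrow> c u \<noteq> c w))"

definition copies :: "'w set \<Rightarrow> 'w set set \<Rightarrow> 'v set \<Rightarrow> 'v set set \<Rightarrow> 'w set set set" where
  "copies VG EG VF EF =
     {(\<lambda>e. \<phi> ` e) ` EF | \<phi>. inj_on \<phi> VF \<and> \<phi> ` VF \<subseteq> VG \<and> (\<forall>e\<in>EF. \<phi> ` e \<in> EG)}"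

definition weakly_sat :: "('w set set \<Rightarrow> bool) \<Rightarrow> 'w set \<Rightarrow> 'w set set \<Rightarrow> 'v set \<Rightarrow> 'v set set \<Rightarrow> bool" where
  "weakly_sat indep VG EG VF EF \<longleftrightarrow>
     (\<forall>T\<in>copies VG EG VF EF. \<forall>e\<in>T. mrank indep (T - {e}) = mrank indep T)"

definition rk_sat :: "'w set \<Rightarrow> 'w set set \<Rightarrow> 'v set \<Rightarrow> 'v set set \<Rightarrow> nat" where
  "rk_sat VG EG VF EF =
     Max {mrank indep EG | indep. matroid EG indep \<and> weakly_sat indep VG EG VF EF}"

definition Kverts :: "nat \<Rightarrow> nat \<Rightarrow> (nat \<times> nat) set" where
  "Kverts n d = {0..<d} \<times> {0..<n}"

definition Kedges :: "nat \<Rightarrow> nat \<Rightarrow> (nat \<times> nat) set set" where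
  "Kedges n d = {{x, y} | x y. x \<in> Kverts n d \<and> y \<in> Kverts n d \<and> fst x \<noteq> fst y}"

end

theory Submission
  imports Defs "HOL-Combinatorics.Transposition"
begin

text \<open>
  Write \<open>f n\<close> for the saturation rank, split the vertices into blocks \<open>{0..<d} \<times> {i}\<close>, and for
  a weakly saturated matroid let \<open>g S\<close> be the rank of the edges inside the blocks indexed by \<open>S\<close>.
  An edge joining two blocks \<open>i, j \<notin> S\<close> closes a copy of \<open>F\<close> whose other edges avoid one of the
  two blocks, as soon as \<open>card S\<close> is at least the order of \<open>F\<close>. So the increments of \<open>g\<close> decrease
  with \<open>S\<close> once \<open>S\<close> is large; in particular the increments of \<open>f\<close> are bounded. Let \<open>a\<close> be the
  least eventual bound on them. If \<open>a > 0\<close>, then for infinitely many \<open>n\<close> an optimal matroid loses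
  rank at least \<open>a\<close> with any block; hence all increments of its \<open>g\<close> are at least \<open>a\<close>, and
  restricting it to \<open>m\<close> blocks shows that \<open>f m - a m\<close> is bounded below. As \<open>f m - a m\<close> is also
  eventually nonincreasing, it is eventually constant.
\<close>

section \<open>Matroid rank\<close>

lemma matroid_indep_finite: "matroid E indep \<Longrightarrow> indep I \<Longrightarrow> finite I"
  unfolding matroid_def by (meson finite_subset)

lemma finite_indep_cards:
  assumes "matroid E indep"
  shows "finite {card I | I. I \<subseteq> X \<and> indep I}"
proof (rule finite_subset)
  have "finite E" "\<And>I. indep I \<Longrightarrow> I \<subseteq> E"
    using assms unfolding matroid_def by auto
  then show "{card I | I. I \<subseteq> X \<and> indep I} \<subseteq> {..card E}"
    by (auto intro: card_mono)
qed simp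

lemma card_le_mrank:
  "matroid E indep \<Longrightarrow> indep I \<Longrightarrow> I \<subseteq> X \<Longrightarrow> card I \<le> mrank indep X"
  unfolding mrank_def by (rule Max_ge[OF finite_indep_cards]) auto

lemma mrank_basis:
  assumes "matroid E indep"
  obtains B where "B \<subseteq> X" "indep B" "card B = mrank indep X"
proof -
  have "indep {}" using assms unfolding matroid_def by simp
  then have "{card I | I. I \<subseteq> X \<and> indep I} \<noteq> {}" by auto
  from Max_in[OF finite_indep_cards[OF assms] this] show ?thesis
    using that unfolding mrank_def by auto
qed

lemma mrank_mono:
  "matroid E indep \<Longrightarrow> X \<subseteq> Y \<Longrightarrow> mrank indep X \<le> mrank indep Y"
  by (metis card_le_mrank mrank_basis subset_trans)

text \<open>Augmenting \<open>I\<close> from a maximum independent subset of \<open>X\<close> stays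
  inside \<open>X\<close>. Each step lowers the deficit \<open>mrank indep X - card I\<close>, on
  which the induction runs.\<close>

lemma indep_extends_to_basis:
  assumes M: "matroid E indep" and "indep I" "I \<subseteq> X"
  obtains B where "I \<subseteq> B" "B \<subseteq> X" "indep B" "card B = mrank indep X"
proof -
  have "\<exists>B. I \<subseteq> B \<and> B \<subseteq> X \<and> indep B \<and> card B = mrank indep X"
    using assms(2,3)
  proof (induction "mrank indep X - card I" arbitrary: I rule: less_induct)
    case less
    show ?case
    proof (cases "card I = mrank indep X")
      case True
      then show ?thesis using less.prems by blast
    next
      case False
      then have lt: "card I < mrank indep X"
        using card_le_mrank[OF M less.prems] by simp
      obtain J where J: "J \<subseteq> X" "indep J" "card J = mrank indep X"
        using mrank_basis[OF M] .
      then obtain x where x: "x \<in> J - I" "indep (insert x I)"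
        using M less.prems lt unfolding matroid_def by metis
      have "card (insert x I) = Suc (card I)"
        using x matroid_indep_finite[OF M less.prems(1)] by simp
      then show ?thesis
        using less.hyps[of "insert x I"] lt x J(1) less.prems(2)
        by (metis Diff_iff diff_less_mono2 insert_subset lessI subset_iff)
    qed
  qed
  then show ?thesis using that by blast
qed

text \<open>A basis \<open>A\<close> of \<open>X \<inter> Y\<close> extends to a basis
  \<open>B\<close> of \<open>X \<union> Y\<close>. The traces of \<open>B\<close> on
  \<open>X\<close> and \<open>Y\<close> are independent, cover \<open>B\<close>, and meet in a set
  containing \<open>A\<close>.\<close>

lemma mrank_submodular:
  assumes M: "matroid E indep"
  shows "mrank indep (X \<union> Y) + mrank indep (X \<inter> Y) \<le> mrank indep X + mrank indep Y"
proof -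
  obtain A where A: "A \<subseteq> X \<inter> Y" "indep A" "card A = mrank indep (X \<inter> Y)"
    using mrank_basis[OF M] .
  obtain B where B: "A \<subseteq> B" "B \<subseteq> X \<union> Y" "indep B" "card B = mrank indep (X \<union> Y)"
    using indep_extends_to_basis[OF M A(2), of "X \<union> Y"] A(1) by blast
  have sub: "indep J" if "J \<subseteq> B" for J
    using M B(3) that unfolding matroid_def by blast
  have fin: "finite B" using matroid_indep_finite[OF M B(3)] .
  have "card B + card (B \<inter> (X \<inter> Y)) = card (B \<inter> X) + card (B \<inter> Y)"
  proof -
    have "B = (B \<inter> X) \<union> (B \<inter> Y)" "B \<inter> (X \<inter> Y) = (B \<inter> X) \<inter> (B \<inter> Y)"
      using B(2) by auto
    then show ?thesis
      using card_Un_Int[of "B \<inter> X" "B \<inter> Y"] fin by simp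
  qed
  moreover have "card A \<le> card (B \<inter> (X \<inter> Y))"
    using A(1) B(1) fin by (intro card_mono) auto
  moreover have "card (B \<inter> X) \<le> mrank indep X" "card (B \<inter> Y) \<le> mrank indep Y"
    by (auto intro!: card_le_mrank[OF M] sub)
  ultimately show ?thesis using A(3) B(4) by linarith
qed

text \<open>Monotonicity of closure: submodularity for \<open>insert e A\<close> and
  \<open>B\<close>, which meet exactly in \<open>A\<close> when \<open>e \<notin> B\<close>.\<close>

lemma mrank_insert_eq_mono:
  assumes M: "matroid E indep" and "A \<subseteq> B" and "mrank indep (insert e A) = mrank indep A"
  shows "mrank indep (insert e B) = mrank indep B"
proof (cases "e \<in> B")
  case True
  then show ?thesis by (simp add: insert_absorb)
next
  case False
  then have "insert e A \<union> B = insert e B" "insert e A \<inter> B = A"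
    using assms(2) by auto
  then have "mrank indep (insert e B) \<le> mrank indep B"
    using mrank_submodular[OF M, of "insert e A" B] assms(3) by simp
  then show ?thesis
    using mrank_mono[OF M subset_insertI, of B e] by linarith
qed

lemma mrank_Un_eq:
  assumes M: "matroid E indep" and "finite Z"
    and "\<And>z. z \<in> Z \<Longrightarrow> mrank indep (insert z A) = mrank indep A"
  shows "mrank indep (A \<union> Z) = mrank indep A"
  using assms(2,3)
proof (induction Z rule: finite_induct)
  case (insert z Z)
  have "mrank indep (insert z (A \<union> Z)) = mrank indep (A \<union> Z)"
    by (rule mrank_insert_eq_mono[OF M, of A]) (use insert.prems in auto)
  then show ?case using insert by simp
qed simp

section \<open>Saturation rank\<close>

lemma finite_weakly_sat_ranks:
  "finite EG \<Longrightarrow> finite {mrank indep EG | indep. matroid EG indep \<and> weakly_sat indep VG EG VF EF}"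
proof (rule finite_subset)
  assume "finite EG"
  then show "{mrank indep EG | indep. matroid EG indep \<and> weakly_sat indep VG EG VF EF}
      \<subseteq> {..card EG}"
    by clarsimp (metis card_mono mrank_basis)
qed simp

lemma rk_sat_ge:
  "matroid EG indep \<Longrightarrow> weakly_sat indep VG EG VF EF \<Longrightarrow> mrank indep EG \<le> rk_sat VG EG VF EF"
  unfolding rk_sat_def
  by (rule Max_ge[OF finite_weakly_sat_ranks]) (auto simp: matroid_def)

text \<open>The rank-zero matroid is weakly saturated for every \<open>F\<close>, so the maximum is
  taken over a nonempty set.\<close>

lemma rk_sat_attained:
  assumes "finite EG"
  obtains indep where "matroid EG indep" "weakly_sat indep VG EG VF EF"
    "mrank indep EG = rk_sat VG EG VF EF"
proof -
  have "matroid EG (\<lambda>I. I = {})"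
    using assms unfolding matroid_def by auto
  moreover have "mrank (\<lambda>I. I = {}) X = 0" for X :: "'a set set"
  proof -
    have "{card I | I. I \<subseteq> X \<and> I = {}} = {0}" by auto
    then show ?thesis unfolding mrank_def by simp
  qed
  then have "weakly_sat (\<lambda>I. I = {}) VG EG VF EF"
    unfolding weakly_sat_def by simp
  ultimately have "{mrank indep EG | indep. matroid EG indep \<and> weakly_sat indep VG EG VF EF} \<noteq> {}"
    by blast
  from Max_in[OF finite_weakly_sat_ranks[OF assms] this] show ?thesis
    using that unfolding rk_sat_def by auto
qed

section \<open>Pulling matroids back along embeddings of graphs\<close>

definition pullback :: "'e set \<Rightarrow> ('e \<Rightarrow> 'f) \<Rightarrow> ('f set \<Rightarrow> bool) \<Rightarrow> 'e set \<Rightarrow> bool" where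
  "pullback E h indep I \<longleftrightarrow> I \<subseteq> E \<and> indep (h ` I)"

lemma matroid_pullback:
  assumes M: "matroid E indep" and "finite E'" and inj: "inj_on h E'"
  shows "matroid E' (pullback E' h indep)"
  unfolding matroid_def
proof (intro conjI allI impI)
  show "finite E'" by fact
  show "pullback E' h indep {}"
    using M unfolding matroid_def pullback_def by simp
  show "I \<subseteq> E'" if "pullback E' h indep I" for I
    using that unfolding pullback_def by simp
  show "pullback E' h indep J" if "pullback E' h indep I \<and> J \<subseteq> I" for I J
    using that M unfolding matroid_def pullback_def by (meson image_mono subset_trans)
  fix I J
  assume IJ: "pullback E' h indep I \<and> pullback E' h indep J \<and> card I < card J"
  then have "card (h ` I) < card (h ` J)"
    using inj unfolding pullback_def by (metis card_image inj_on_subset)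
  then obtain y where y: "y \<in> h ` J - h ` I" "indep (insert y (h ` I))"
    using M IJ unfolding matroid_def pullback_def by metis
  then obtain x where "x \<in> J" "y = h x" by blast
  with y IJ show "\<exists>x\<in>J - I. pullback E' h indep (insert x I)"
    unfolding pullback_def by (intro bexI[of _ x]) auto
qed

lemma mrank_pullback:
  assumes inj: "inj_on h E'" and "X \<subseteq> E'"
  shows "mrank (pullback E' h indep) X = mrank indep (h ` X)"
proof -
  have "{card I | I. I \<subseteq> X \<and> pullback E' h indep I} = {card I | I. I \<subseteq> h ` X \<and> indep I}"
    (is "?L = ?R")
  proof
    show "?L \<subseteq> ?R"
    proof
      fix c assume "c \<in> ?L"
      then obtain I where I: "c = card I" "I \<subseteq> X" "indep (h ` I)"
        unfolding pullback_def by blast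
      then have "c = card (h ` I)"
        using inj assms(2) by (metis card_image inj_on_subset)
      then show "c \<in> ?R" using I by blast
    qed
    show "?R \<subseteq> ?L"
    proof
      fix c assume "c \<in> ?R"
      then obtain J where J: "c = card J" "J \<subseteq> h ` X" "indep J" by blast
      then obtain I where I: "I \<subseteq> X" "J = h ` I" by (auto simp: subset_image_iff)
      then have "c = card I"
        using J inj assms(2) by (metis card_image inj_on_subset)
      then show "c \<in> ?L"
        using I J assms(2) unfolding pullback_def by blast
    qed
  qed
  then show ?thesis unfolding mrank_def by simp
qed

text \<open>Composition with \<open>\<psi>\<close> turns copies of \<open>F\<close> in the small
  graph into copies in the large one. The pullback is therefore weakly saturated and competes in the
  maximum for the small graph.\<close>

lemma mrank_embedding_le_rk_sat:
  assumes M: "matroid EG indep" and W: "weakly_sat indep VG EG VF EF"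
    and fin: "finite EH" and sub: "\<And>e. e \<in> EH \<Longrightarrow> e \<subseteq> VH"
    and inj: "inj_on \<psi> VH" and verts: "\<psi> ` VH \<subseteq> VG" and edges: "\<And>e. e \<in> EH \<Longrightarrow> \<psi> ` e \<in> EG"
  shows "mrank indep ((\<lambda>e. \<psi> ` e) ` EH) \<le> rk_sat VH EH VF EF"
proof -
  let ?h = "\<lambda>e. \<psi> ` e"
  let ?ind = "pullback EH ?h indep"
  have injE: "inj_on ?h EH"
    using inj sub by (meson inj_onI inj_on_image_eq_iff)
  have "weakly_sat ?ind VH EH VF EF"
    unfolding weakly_sat_def
  proof (intro ballI)
    fix T e assume "T \<in> copies VH EH VF EF" and e: "e \<in> T"
    then obtain \<phi> where \<phi>: "T = (\<lambda>e. \<phi> ` e) ` EF" "inj_on \<phi> VF" "\<phi> ` VF \<subseteq> VH"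
      "\<forall>e\<in>EF. \<phi> ` e \<in> EH"
      unfolding copies_def by blast
    have TE: "T \<subseteq> EH" using \<phi> by auto
    have "?h ` T = (\<lambda>e. (\<psi> \<circ> \<phi>) ` e) ` EF"
      unfolding \<phi>(1) by (simp add: image_image)
    moreover have "inj_on (\<psi> \<circ> \<phi>) VF"
      using \<phi> inj by (meson comp_inj_on inj_on_subset)
    moreover have "(\<psi> \<circ> \<phi>) ` VF \<subseteq> VG"
      using \<phi>(3) verts by (auto simp: image_subset_iff)
    moreover have "\<forall>e\<in>EF. (\<psi> \<circ> \<phi>) ` e \<in> EG"
      using \<phi>(4) edges by (metis image_comp)
    ultimately have "?h ` T \<in> copies VG EG VF EF"
      unfolding copies_def by blast
    then have "mrank indep (?h ` T - {?h e}) = mrank indep (?h ` T)"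
      using W e unfolding weakly_sat_def by blast
    \<comment> \<open>By injectivity on edges, deleting the image of \<open>e\<close> deletes no
      other edge.\<close>
    moreover have "?h ` T - {?h e} = ?h ` (T - {e})"
      using inj_on_image_set_diff[OF injE, of T "{e}"] TE e by auto
    ultimately show "mrank ?ind (T - {e}) = mrank ?ind T"
      using TE mrank_pullback[OF injE] by (metis Diff_subset subset_trans)
  qed
  then have "mrank ?ind EH \<le> rk_sat VH EH VF EF"
    by (intro rk_sat_ge matroid_pullback[OF M fin injE])
  then show ?thesis
    using mrank_pullback[OF injE, of EH indep] by simp
qed

section \<open>Blocks of the complete multipartite graph\<close>

text \<open>A vertex \<open>(p, i)\<close> lies in part \<open>p\<close> and block \<open>i\<close>.
  Infinite \<open>S\<close> is allowed: with \<open>UNIV\<close> the shape of an edge is separated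
  from its location.\<close>

definition block_edges :: "nat \<Rightarrow> nat set \<Rightarrow> (nat \<times> nat) set set" where
  "block_edges d S = {{(p, i), (q, j)} | p q i j. p < d \<and> q < d \<and> p \<noteq> q \<and> i \<in> S \<and> j \<in> S}"

lemma block_edgesI:
  "p < d \<Longrightarrow> q < d \<Longrightarrow> p \<noteq> q \<Longrightarrow> i \<in> S \<Longrightarrow> j \<in> S \<Longrightarrow> {(p, i), (q, j)} \<in> block_edges d S"
  unfolding block_edges_def by blast

lemma block_edgesE:
  assumes "e \<in> block_edges d S"
  obtains p q i j where "e = {(p, i), (q, j)}" "p < d" "q < d" "p \<noteq> q" "i \<in> S" "j \<in> S"
  using assms unfolding block_edges_def by blast

lemma Kedges_eq_block_edges: "Kedges n d = block_edges d {0..<n}"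
  unfolding Kedges_def Kverts_def block_edges_def by fastforce

lemma block_edges_mono: "S \<subseteq> T \<Longrightarrow> block_edges d S \<subseteq> block_edges d T"
  unfolding block_edges_def by blast

lemma finite_block_edges: "finite S \<Longrightarrow> finite (block_edges d S)"
  by (rule finite_subset[of _ "Pow ({0..<d} \<times> S)"]) (auto simp: block_edges_def)

lemma block_edges_iff:
  "e \<in> block_edges d S \<longleftrightarrow> e \<in> block_edges d UNIV \<and> snd ` e \<subseteq> S"
proof
  show "e \<in> block_edges d UNIV \<and> snd ` e \<subseteq> S" if "e \<in> block_edges d S"
    using that by (auto elim!: block_edgesE intro!: block_edgesI)
  assume e: "e \<in> block_edges d UNIV \<and> snd ` e \<subseteq> S"
  then obtain p q i j where "e = {(p, i), (q, j)}" "p < d" "q < d" "p \<noteq> q"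
    by (auto elim: block_edgesE)
  with e show "e \<in> block_edges d S" by (auto intro!: block_edgesI)
qed

lemma block_edges_Int: "block_edges d S \<inter> block_edges d T = block_edges d (S \<inter> T)"
  by (rule set_eqI) (simp add: block_edges_iff[of _ d S] block_edges_iff[of _ d T]
    block_edges_iff[of _ d "S \<inter> T"], blast)

lemma image_block_edges:
  "(\<lambda>e. map_prod id h ` e) ` block_edges d S = block_edges d (h ` S)" (is "?L = ?R")
proof
  show "?L \<subseteq> ?R"
    by (auto elim!: block_edgesE intro!: block_edgesI)
  show "?R \<subseteq> ?L"
  proof
    fix e assume "e \<in> ?R"
    then obtain p q i j where e: "e = {(p, h i), (q, h j)}" "p < d" "q < d" "p \<noteq> q" "i \<in> S" "j \<in> S"
      by (auto elim!: block_edgesE)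
    have "map_prod id h ` {(p, i), (q, j)} \<in> ?L"
      by (intro imageI block_edgesI e)
    then show "e \<in> ?L" by (simp add: e(1))
  qed
qed

lemma ex_permutation_two_points:
  fixes a b p q d :: nat
  assumes "a \<noteq> b" "p \<noteq> q" "a < d" "b < d" "p < d" "q < d"
  obtains \<pi> where "inj \<pi>" "\<pi> a = p" "\<pi> b = q" "\<And>x. x < d \<Longrightarrow> \<pi> x < d"
proof
  \<comment> \<open>The first swap takes \<open>a\<close> to \<open>p\<close>; the second takes the
    current image of \<open>b\<close> to \<open>q\<close> and fixes \<open>p\<close>, which is
    neither of the points it swaps.\<close>
  let ?\<pi> = "transpose (transpose a p b) q \<circ> transpose a p"
  show "inj ?\<pi>" by (simp add: inj_compose)
  show "?\<pi> a = p" "?\<pi> b = q" "\<And>x. x < d \<Longrightarrow> ?\<pi> x < d"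
    using assms by (auto simp: transpose_def)
qed

section \<open>Copies of \<open>F\<close> through an edge between two blocks\<close>

context
  fixes d :: nat and VF :: "'v set" and EF :: "'v set set"
  assumes F: "graph VF EF" "EF \<noteq> {}" "d_partite d VF EF"
begin

text \<open>One edge \<open>{x, y}\<close> of \<open>F\<close> is laid on the cross edge and all
  other vertices go to blocks in \<open>S\<close>, which has room for them. No other edge of
  \<open>F\<close> contains both \<open>x\<close> and \<open>y\<close>, so each avoids block
  \<open>i\<close> or block \<open>j\<close>.\<close>

lemma ex_copy_through_cross_edge:
  assumes S: "finite S" "card VF \<le> card S" "S \<subseteq> {0..<n}"
    and ij: "i \<in> {0..<n} - S" "j \<in> {0..<n} - S" "i \<noteq> j"
    and pq: "p < d" "q < d" "p \<noteq> q"
  obtains T where "T \<in> copies (Kverts n d) (Kedges n d) VF EF" "{(p, i), (q, j)} \<in> T"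
    "T - {{(p, i), (q, j)}} \<subseteq> block_edges d (insert i S) \<union> block_edges d (insert j S)"
proof -
  have finV: "finite VF" using F unfolding graph_def by simp
  have edgeF: "e \<subseteq> VF" "card e = 2" if "e \<in> EF" for e
    using F that unfolding graph_def by auto
  obtain c where c: "\<And>v. v \<in> VF \<Longrightarrow> c v < d"
    "\<And>e u w. e \<in> EF \<Longrightarrow> u \<in> e \<Longrightarrow> w \<in> e \<Longrightarrow> u \<noteq> w \<Longrightarrow> c u \<noteq> c w"
    using F(3) unfolding d_partite_def by metis
  obtain e0 where e0: "e0 \<in> EF" using F(2) by blast
  then obtain x y where xy: "e0 = {x, y}" "x \<noteq> y"
    using edgeF(2) card_2_iff by metis
  then have xyV: "x \<in> VF" "y \<in> VF" using edgeF(1) e0 by auto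
  obtain \<pi> where \<pi>: "inj \<pi>" "\<pi> (c x) = p" "\<pi> (c y) = q" "\<And>z. z < d \<Longrightarrow> \<pi> z < d"
    by (rule ex_permutation_two_points[of "c x" "c y" p q d])
       (use c e0 xy xyV pq in auto)
  obtain h0 where h0: "h0 ` VF \<subseteq> S" "inj_on h0 VF"
    using card_le_inj[OF finV S(1,2)] by blast
  \<comment> \<open>Each vertex gets a block of its own; overriding at \<open>x\<close> and
    \<open>y\<close> keeps injectivity because \<open>i\<close> and \<open>j\<close> are distinct
    and outside \<open>S\<close>.\<close>
  define h where "h = h0(x := i, y := j)"
  have hx: "h x = i" and hy: "h y = j" using xy unfolding h_def by auto
  have h_in: "h v \<in> S" if "v \<in> VF" "v \<noteq> x" "v \<noteq> y" for v
    using h0(1) that unfolding h_def by auto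
  have h_inj: "inj_on h VF"
    unfolding h_def using h0 ij by (auto simp: inj_on_def image_subset_iff)
  \<comment> \<open>The permuted colour is the part, so edges go to edges; injectivity comes from
    the blocks alone.\<close>
  define \<phi> where "\<phi> v = (\<pi> (c v), h v)" for v
  have \<phi>_edge: "\<phi> ` e \<in> block_edges d A" if eA: "e \<in> EF" "h ` e \<subseteq> A" for e A
  proof -
    obtain u w where uw: "e = {u, w}" "u \<noteq> w"
      using edgeF(2)[OF eA(1)] card_2_iff by metis
    then have "\<phi> ` e = {(\<pi> (c u), h u), (\<pi> (c w), h w)}" by (simp add: \<phi>_def)
    moreover have "\<pi> (c u) \<noteq> \<pi> (c w)"
      using c(2)[OF eA(1)] uw \<pi>(1) by (auto simp: inj_eq)
    ultimately show ?thesis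
      using uw eA edgeF(1)[OF eA(1)] \<pi>(4) c(1) by (auto intro!: block_edgesI)
  qed
  have hV: "h ` VF \<subseteq> {0..<n}"
    using h_in hx hy ij S(3) by (metis DiffD1 image_subsetI subsetD)
  have "\<phi> ` VF \<subseteq> Kverts n d"
    using hV \<pi>(4) c(1) unfolding \<phi>_def Kverts_def by auto
  moreover have "inj_on \<phi> VF"
    using h_inj unfolding \<phi>_def inj_on_def by auto
  moreover have "\<forall>e\<in>EF. \<phi> ` e \<in> Kedges n d"
    unfolding Kedges_eq_block_edges using \<phi>_edge hV edgeF(1) by (meson image_mono subset_trans)
  ultimately have "(\<lambda>e. \<phi> ` e) ` EF \<in> copies (Kverts n d) (Kedges n d) VF EF"
    unfolding copies_def by blast
  moreover have \<phi>e0: "\<phi> ` e0 = {(p, i), (q, j)}"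
    using xy \<pi> hx hy by (simp add: \<phi>_def)
  then have "{(p, i), (q, j)} \<in> (\<lambda>e. \<phi> ` e) ` EF" using imageI[OF e0, of "\<lambda>e. \<phi> ` e"] by simp
  moreover have "(\<lambda>e. \<phi> ` e) ` EF - {{(p, i), (q, j)}}
    \<subseteq> block_edges d (insert i S) \<union> block_edges d (insert j S)"
  proof
    fix t assume "t \<in> (\<lambda>e. \<phi> ` e) ` EF - {{(p, i), (q, j)}}"
    then obtain e where e: "e \<in> EF" "t = \<phi> ` e" "e \<noteq> e0"
      unfolding \<phi>e0[symmetric] by blast
    have "x \<notin> e \<or> y \<notin> e"
      using e(3) xy edgeF(2)[OF e(1)] by (auto simp: card_2_iff)
    then have "h ` e \<subseteq> insert i S \<or> h ` e \<subseteq> insert j S"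
      using h_in hx hy edgeF(1)[OF e(1)] by blast
    then show "t \<in> block_edges d (insert i S) \<union> block_edges d (insert j S)"
      using \<phi>_edge[OF e(1)] e(2) by blast
  qed
  ultimately show ?thesis using that by blast
qed

text \<open>\<open>?A \<union> ?B\<close> misses only the edges between blocks \<open>i\<close> and
  \<open>j\<close>. Each of these is spanned by the rest of a copy of \<open>F\<close> inside
  \<open>?A \<union> ?B\<close>, so plain submodularity applies with \<open>?U\<close> in place of
  the union.\<close>

lemma mrank_blocks_submodular:
  assumes M: "matroid (Kedges n d) indep"
    and W: "weakly_sat indep (Kverts n d) (Kedges n d) VF EF"
    and S: "S \<subseteq> {0..<n}" "card VF \<le> card S"
    and ij: "i \<in> {0..<n} - S" "j \<in> {0..<n} - S" "i \<noteq> j"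
  defines "g \<equiv> \<lambda>S. mrank indep (block_edges d S)"
  shows "g (insert i (insert j S)) + g S \<le> g (insert i S) + g (insert j S)"
proof -
  let ?A = "block_edges d (insert i S)" and ?B = "block_edges d (insert j S)"
  let ?U = "block_edges d (insert i (insert j S))"
  have finS: "finite S" using S(1) finite_subset by blast
  have "mrank indep (insert z (?A \<union> ?B)) = mrank indep (?A \<union> ?B)" if z: "z \<in> ?U" for z
  proof -
    obtain p q k l where z: "z = {(p, k), (q, l)}" "p < d" "q < d" "p \<noteq> q"
      and kl: "k \<in> insert i (insert j S)" "l \<in> insert i (insert j S)"
      using z by (rule block_edgesE)
    \<comment> \<open>In the first two cases the edge already lies in \<open>?A\<close> or
      \<open>?B\<close>; the last two are the two orientations of a cross edge.\<close>
    consider "k \<in> insert i S" "l \<in> insert i S" | "k \<in> insert j S" "l \<in> insert j S"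
      | "k = i" "l = j" | "k = j" "l = i"
      using kl by blast
    then have "z \<in> ?A \<union> ?B \<or> (\<exists>p q. z = {(p, i), (q, j)} \<and> p < d \<and> q < d \<and> p \<noteq> q)"
    proof cases
      case 1
      then show ?thesis using z(1) block_edgesI[OF z(2-4)] by simp
    next
      case 2
      then show ?thesis using z(1) block_edgesI[OF z(2-4)] by simp
    next
      case 3
      then show ?thesis using z by metis
    next
      case 4
      then have "z = {(q, i), (p, j)}" using z(1) by (simp add: insert_commute)
      then show ?thesis using z(2-4) by metis
    qed
    then show ?thesis
    proof
      assume "\<exists>p q. z = {(p, i), (q, j)} \<and> p < d \<and> q < d \<and> p \<noteq> q"
      then obtain p q where pq: "z = {(p, i), (q, j)}" "p < d" "q < d" "p \<noteq> q" by blast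
      obtain T where T: "T \<in> copies (Kverts n d) (Kedges n d) VF EF" "z \<in> T" "T - {z} \<subseteq> ?A \<union> ?B"
        using ex_copy_through_cross_edge[OF finS S(2,1) ij pq(2-4)] unfolding pq(1) by blast
      then have "mrank indep (insert z (T - {z})) = mrank indep (T - {z})"
        using W unfolding weakly_sat_def by (simp add: insert_absorb)
      then show ?thesis by (rule mrank_insert_eq_mono[OF M T(3)])
    qed (simp add: insert_absorb)
  qed
  then have "mrank indep (?A \<union> ?B \<union> ?U) = mrank indep (?A \<union> ?B)"
    by (intro mrank_Un_eq[OF M] finite_block_edges) (use finS in auto)
  moreover have "?A \<union> ?B \<subseteq> ?U" by (intro Un_least block_edges_mono) auto
  then have "?A \<union> ?B \<union> ?U = ?U" by (rule Un_absorb1)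
  ultimately have U: "mrank indep (?A \<union> ?B) = mrank indep ?U" by (simp only:)
  have "insert i S \<inter> insert j S = S" using ij by auto
  then have Int: "?A \<inter> ?B = block_edges d S" by (simp only: block_edges_Int)
  show ?thesis
    unfolding g_def by (rule mrank_submodular[OF M, of ?A ?B, unfolded U Int])
qed

end

text \<open>Relabelling the blocks in \<open>S\<close> as \<open>{0..<card S}\<close> embeds a
  smaller complete multipartite graph, along which the matroid is pulled back.\<close>

lemma mrank_blocks_le_rk_sat:
  assumes M: "matroid (Kedges n d) indep"
    and W: "weakly_sat indep (Kverts n d) (Kedges n d) VF EF"
    and S: "S \<subseteq> {0..<n}"
  shows "mrank indep (block_edges d S) \<le> rk_sat (Kverts (card S) d) (Kedges (card S) d) VF EF"
proof -
  obtain h where h: "bij_betw h {0..<card S} S"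
    using ex_bij_betw_nat_finite[OF finite_subset[OF S]] by auto
  have "mrank indep ((\<lambda>e. map_prod id h ` e) ` Kedges (card S) d)
    \<le> rk_sat (Kverts (card S) d) (Kedges (card S) d) VF EF"
  proof (rule mrank_embedding_le_rk_sat[OF M W])
    show "finite (Kedges (card S) d)"
      by (simp add: Kedges_eq_block_edges finite_block_edges)
    show "e \<subseteq> Kverts (card S) d" if "e \<in> Kedges (card S) d" for e
      using that unfolding Kedges_def by auto
    show "inj_on (map_prod id h) (Kverts (card S) d)"
      unfolding Kverts_def using bij_betw_imp_inj_on[OF h] by (auto simp: inj_on_def)
    show "map_prod id h ` Kverts (card S) d \<subseteq> Kverts n d"
      unfolding Kverts_def using bij_betw_imp_surj_on[OF h] S by auto
    show "map_prod id h ` e \<in> Kedges n d" if "e \<in> Kedges (card S) d" for e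
    proof -
      have "map_prod id h ` e \<in> block_edges d (h ` {0..<card S})"
        using imageI[OF that, of "\<lambda>e. map_prod id h ` e"]
        by (simp only: Kedges_eq_block_edges image_block_edges)
      then show ?thesis
        unfolding Kedges_eq_block_edges
        using bij_betw_imp_surj_on[OF h] block_edges_mono[OF S] by auto
    qed
  qed
  then show ?thesis
    unfolding Kedges_eq_block_edges[of "card S"] image_block_edges bij_betw_imp_surj_on[OF h] .
qed

section \<open>Eventual linearity\<close>

text \<open>Elements of \<open>T - S\<close> are added to \<open>S\<close> one at a time, summing
  the local inequalities; the size bound \<open>k\<close> persists since the sets only grow.\<close>

lemma local_submodular_increment_antimono:
  fixes g :: "'i set \<Rightarrow> nat"
  assumes sub: "\<And>S i j. S \<subseteq> X \<Longrightarrow> k \<le> card S \<Longrightarrow> i \<in> X - S \<Longrightarrow> j \<in> X - S \<Longrightarrow> i \<noteq> j \<Longrightarrow>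
      g (insert i (insert j S)) + g S \<le> g (insert i S) + g (insert j S)"
    and "finite X" "S \<subseteq> T" "T \<subseteq> X" "k \<le> card S" "i \<in> X - T"
  shows "g (insert i T) + g S \<le> g (insert i S) + g T"
proof -
  have fin: "finite T" using assms(2,4) by (rule rev_finite_subset)
  then have "finite (T - S)" by simp
  moreover have "R \<subseteq> T - S \<Longrightarrow> g (insert i (S \<union> R)) + g S \<le> g (insert i S) + g (S \<union> R)"
    if "finite R" for R
    using that
  proof (induction R rule: finite_induct)
    case (insert j R)
    have "card S \<le> card (S \<union> R)"
      using finite_subset[OF assms(3) fin] insert.hyps by (intro card_mono) auto
    then have "g (insert i (insert j (S \<union> R))) + g (S \<union> R)
      \<le> g (insert i (S \<union> R)) + g (insert j (S \<union> R))"
      by (intro sub) (use assms insert in auto)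
    then show ?case using insert by simp
  qed simp
  ultimately show ?thesis using assms(3) by (metis Un_Diff_cancel Un_absorb1 order_refl)
qed

text \<open>The gap \<open>h n - L\<close> is a natural number, so it is least at some
  \<open>m\<close>; from there \<open>h\<close> can neither rise nor fall.\<close>

lemma antimono_bounded_below_eventually_const:
  fixes h :: "nat \<Rightarrow> int"
  assumes dec: "\<And>n. n \<ge> N \<Longrightarrow> h (Suc n) \<le> h n" and lb: "\<And>n. n \<ge> N \<Longrightarrow> L \<le> h n"
  shows "\<exists>C N'. \<forall>n\<ge>N'. h n = C"
proof -
  obtain m where m: "m \<ge> N" "\<And>n. n \<ge> N \<Longrightarrow> nat (h m - L) \<le> nat (h n - L)"
    using ex_has_least_nat[of "\<lambda>n. n \<ge> N" N "\<lambda>n. nat (h n - L)"] by blast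
  have "h n = h m" if "n \<ge> m" for n
  proof -
    have "h n \<le> h m"
      using that
    proof (induction n rule: dec_induct)
      case (step l)
      then show ?case using dec[of l] m(1) by linarith
    qed simp
    moreover have "nat (h m - L) \<le> nat (h n - L)" "L \<le> h n" "L \<le> h m"
      using m that lb by auto
    ultimately show ?thesis by linarith
  qed
  then show ?thesis by blast
qed

text \<open>Here \<open>g n\<close> comes from an optimal matroid on \<open>n\<close> blocks. The
  functions for different \<open>n\<close> are unrelated and are compared only through
  \<open>f\<close>.\<close>

lemma eventually_linear_if_local_submodular:
  fixes f :: "nat \<Rightarrow> nat" and g :: "nat \<Rightarrow> nat set \<Rightarrow> nat"
  assumes top: "\<And>n. g n {0..<n} = f n"
    and le: "\<And>n S. S \<subseteq> {0..<n} \<Longrightarrow> g n S \<le> f (card S)"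
    and sub: "\<And>n S i j. S \<subseteq> {0..<n} \<Longrightarrow> k \<le> card S \<Longrightarrow> i \<in> {0..<n} - S \<Longrightarrow> j \<in> {0..<n} - S \<Longrightarrow>
      i \<noteq> j \<Longrightarrow> g n (insert i (insert j S)) + g n S \<le> g n (insert i S) + g n (insert j S)"
  shows "\<exists>(a::nat) (C::int) (N::nat). \<forall>n\<ge>N. int (f n) = int a * int n + C"
proof -
  \<comment> \<open>The increment of \<open>i\<close> over \<open>S\<close> is at least its
    increment over all other blocks, which is at least \<open>f (Suc n) - f n\<close> because the
    other blocks have rank at most \<open>f n\<close>.\<close>
  have drop: "f (Suc n) + g (Suc n) S \<le> g (Suc n) (insert i S) + f n"
    if "S \<subseteq> {0..<Suc n}" "k \<le> card S" "i \<in> {0..<Suc n} - S" for n S i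
  proof -
    let ?T = "{0..<Suc n} - {i}"
    have "g (Suc n) (insert i ?T) + g (Suc n) S \<le> g (Suc n) (insert i S) + g (Suc n) ?T"
      by (rule local_submodular_increment_antimono
          [where X = "{0..<Suc n}" and g = "g (Suc n)", OF sub]) (use that in auto)
    moreover have "insert i ?T = {0..<Suc n}" using that by auto
    moreover have "g (Suc n) ?T \<le> f n"
      using le[of ?T "Suc n"] that by simp
    ultimately show ?thesis using top[of "Suc n"] by simp
  qed
  define P where "P a \<longleftrightarrow> (\<exists>N. \<forall>n\<ge>N. f (Suc n) \<le> f n + a)" for a
  \<comment> \<open>With \<open>S = {0..<k}\<close>, \<open>drop\<close> bounds the increment of
    \<open>f\<close> by the rank of \<open>k + 1\<close> blocks.\<close>
  have "P (f (Suc k))"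
    unfolding P_def
  proof (intro exI allI impI)
    fix n assume "n \<ge> k"
    then have "f (Suc n) + g (Suc n) {0..<k} \<le> g (Suc n) (insert n {0..<k}) + f n"
      by (intro drop) auto
    moreover have "g (Suc n) (insert n {0..<k}) \<le> f (Suc k)"
      using le[of "insert n {0..<k}" "Suc n"] \<open>n \<ge> k\<close> by simp
    ultimately show "f (Suc n) \<le> f n + f (Suc k)" by simp
  qed
  define a where "a = (LEAST a. P a)"
  have "P a" unfolding a_def using \<open>P (f (Suc k))\<close> by (rule LeastI)
  then obtain N where N: "\<And>n. n \<ge> N \<Longrightarrow> f (Suc n) \<le> f n + a" unfolding P_def by blast
  have lower: "a * (m - k) \<le> f m" for m
  proof (cases a)
    case (Suc b)
    \<comment> \<open>By minimality \<open>a - 1\<close> is not an eventual bound, so some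
      \<open>n \<ge> m\<close> has increment at least \<open>a\<close>; its matroid contains the
      blocks below \<open>m\<close>.\<close>
    then have "\<not> P b" using not_less_Least[of b P] unfolding a_def by simp
    then obtain n where n: "n \<ge> m" "f n + a \<le> f (Suc n)"
      unfolding P_def Suc by (metis add_Suc_right not_less_eq_eq)
    \<comment> \<open>By \<open>drop\<close>, every block from index \<open>k\<close> on adds at
      least \<open>a\<close>; up to \<open>l = k\<close> truncated subtraction makes the claim
      trivial.\<close>
    have "l \<le> Suc n \<Longrightarrow> a * (l - k) \<le> g (Suc n) {0..<l}" for l
    proof (induction l)
      case (Suc l)
      show ?case
      proof (cases "k \<le> l")
        case True
        have "f (Suc n) + g (Suc n) {0..<l} \<le> g (Suc n) (insert l {0..<l}) + f n"
          using Suc.prems True by (intro drop) auto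
        then have "g (Suc n) {0..<l} + a \<le> g (Suc n) {0..<Suc l}"
          using n(2) by (simp add: atLeast0_lessThan_Suc)
        then show ?thesis using Suc True by (simp add: Suc_diff_le)
      qed simp
    qed simp
    from this[of m] show ?thesis
      using le[of "{0..<m}" "Suc n"] n(1) by simp
  qed simp
  have "\<exists>C N'. \<forall>n\<ge>N'. int (f n) - int a * int n = C"
  proof (rule antimono_bounded_below_eventually_const)
    show "int (f (Suc n)) - int a * int (Suc n) \<le> int (f n) - int a * int n" if "n \<ge> N" for n
      using N[OF that] by (simp add: algebra_simps)
    show "- (int a * int k) \<le> int (f n) - int a * int n" for n
    proof -
      have "int a * (int n - int k) \<le> int a * int (n - k)"
        by (intro mult_left_mono) auto
      also have "\<dots> \<le> int (f n)"
        using lower[of n] by (metis of_nat_le_iff of_nat_mult)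
      finally show ?thesis by (simp add: algebra_simps)
    qed
  qed
  then show ?thesis by (metis add.commute diff_add_cancel)
qed

theorem theorem6:
  fixes d :: nat and VF :: "'v set" and EF :: "'v set set"
  assumes "d \<ge> 2"
    and "graph VF EF"
    and "EF \<noteq> {}"
    and "d_partite d VF EF"
  shows "\<exists>(a::nat) (C::int) (N::nat). \<forall>n\<ge>N.
           int (rk_sat (Kverts n d) (Kedges n d) VF EF) = int a * int n + C"
proof -
  \<comment> \<open>An optimal matroid is fixed for each \<open>n\<close> separately, with no
    compatibility between them.\<close>
  have "\<exists>indep. matroid (Kedges n d) indep \<and> weakly_sat indep (Kverts n d) (Kedges n d) VF EF \<and>
      mrank indep (Kedges n d) = rk_sat (Kverts n d) (Kedges n d) VF EF" for n
    using rk_sat_attained[of "Kedges n d" "Kverts n d" VF EF]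
    by (metis Kedges_eq_block_edges finite_atLeastLessThan finite_block_edges)
  then obtain M where M: "\<And>n. matroid (Kedges n d) (M n)"
    "\<And>n. weakly_sat (M n) (Kverts n d) (Kedges n d) VF EF"
    "\<And>n. mrank (M n) (Kedges n d) = rk_sat (Kverts n d) (Kedges n d) VF EF"
    by metis
  show ?thesis
  proof (rule eventually_linear_if_local_submodular
      [where g = "\<lambda>n S. mrank (M n) (block_edges d S)" and k = "card VF"])
    show "mrank (M n) (block_edges d {0..<n}) = rk_sat (Kverts n d) (Kedges n d) VF EF" for n
      using M(3)[of n] by (simp add: Kedges_eq_block_edges)
  qed (fact mrank_blocks_le_rk_sat[OF M(1,2)] mrank_blocks_submodular[OF assms(2-4) M(1,2)])+
qed

end
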